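(* Let $X$ be a nonempty compact metric space without isolated points and let $f_{1,\infty} = (f_n)_{n=1}^\infty$ be a nonautonomous dynamical system on $X$. Then the following ten conditions on $f_{1,\infty}$ are equivalent. (TT) For every pair of nonempty open sets $U,V\subset X$ there is an $n\in\mathbb{N}$ such that $f_{1,n}(U)\cap V\neq\emptyset$. (TT$_0$) For every pair of nonempty open sets $U,V\subset X$ there is an $n\in\mathbb{N}\cup\{0\}$ such that $f_{1,n}(U)\cap V\neq\emptyset$. (OP) For every nonempty open $U\subset X$ the set $\bigcup_{n=1}^\infty f_{1,n}(U)$ is dense in $X$. (OP$_0$) For every nonempty open $U\subset X$ the set $\bigcup_{n=0}^\infty f_{1,n}(U)$ is dense in $X$. (TT$^{-}$) For every pair of nonempty open sets $U,V\subset X$ there is an $n\in\mathbb{N}$ such that $f_{1,n}^{-1}(U)\cap V\neq\emptyset$. (TT$_0^{-}$) For every pair of nonempty open sets $U,V\subset X$ there is an $n\in\mathbb{N}\cup\{0\}$ such that $f_{1,n}^{-1}(U)\cap V\neq\emptyset$. (OP$^{-}$) For every nonempty open $U\subset X$ the set $\bigcup_{n=1}^\infty f_{1,n}^{-1}(U)$ is dense in $X$. (OP$_0^{-}$) For every nonempty open $U\subset X$ the set $\bigcup_{n=0}^\infty f_{1,n}^{-1}(U)$ is dense in $X$. (DDO) There is a dense $G_\delta$ set $A\subset X$ such that $\operatorname{Orb}_{f_{1,\infty}}(x)$ is dense in $X$ for every $x\in A$. (D$\omega$) There is a dense $G_\delta$ set $A\subset X$ such that $\omega_{f_{1,\infty}}(x)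 = X$ for every $x\in A$. Moreover, each of these ten conditions implies the following two conditions, which are equivalent to each other: ($\omega$) There is an $x\in X$ such that $\omega_{f_{1,\infty}}(x) = X$. (DO) There is an $x\in X$ whose orbit $\operatorname{Orb}_{f_{1,\infty}}(x)$ is dense in $X$. The converse implications do not hold in general: there is a nonautonomous dynamical system on a nonempty compact metric space without isolated points which satisfies ($\omega$) and (DO) but none of the ten conditions above.
   Context: A nonautonomous dynamical system on a compact metric space $X$ is a sequence $f_{1,\infty} = f_1,f_2,f_3,\ldots$ of continuous maps from $X$ to $X$. For a positive integer $n$ put $f_{1,n} = f_n\circ f_{n-1}\circ\cdots\circ f_1$, and put $f_{1,0} = \mathrm{id}_X$. For $A\subset X$, $f_{1,n}^{-1}(A)$ denotes the preimage $(f_{1,n})^{-1}(A)$ of $A$ under the map $f_{1,n}$. The orbit of $x\in X$ is $\operatorname{Orb}_{f_{1,\infty}}(x) = \{x, f_{1,1}(x), f_{1,2}(x),\ldots\}$. The omega-limit set $\omega_{f_{1,\infty}}(x)$ is the set of all limit points of the sequence $(f_{1,n}(x))_{n=1}^\infty$, i.e. the set of all limits of convergent subsequences of this sequence. $\mathbb{N}$ denotes the set of positive integers. *)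

theory Defs
  imports "HOL-Analysis.Analysis"
begin

definition no_isolated_points :: "'a topology \<Rightarrow> bool" where
  "no_isolated_points X \<longleftrightarrow> (\<forall>x\<in>topspace X. \<not> openin X {x})"

definition dense_subset :: "'a topology \<Rightarrow> 'a set \<Rightarrow> bool" where
  "dense_subset X A \<longleftrightarrow> A \<subseteq> topspace X \<and> X closure_of A = topspace X"

text \<open>A nonautonomous system is the sequence f 1, f 2, ...; the map f 0 is never used,
  and the values of the maps outside the space are irrelevant.\<close>

definition nonautonomous_system :: "'a topology \<Rightarrow> (nat \<Rightarrow> 'a \<Rightarrow> 'a) \<Rightarrow> bool" where
  "nonautonomous_system X f \<longleftrightarrow> (\<forall>n\<ge>1. continuous_map X X (f n))"

primrec iter :: "(nat \<Rightarrow> 'a \<Rightarrow> 'a) \<Rightarrow> nat \<Rightarrow> 'a \<Rightarrow> 'a" where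
  "iter f 0 = id"
| "iter f (Suc n) = f (Suc n) \<circ> iter f n"

definition iter_preimage :: "'a topology \<Rightarrow> (nat \<Rightarrow> 'a \<Rightarrow> 'a) \<Rightarrow> nat \<Rightarrow> 'a set \<Rightarrow> 'a set" where
  "iter_preimage X f n A = {x \<in> topspace X. iter f n x \<in> A}"

definition orbit :: "(nat \<Rightarrow> 'a \<Rightarrow> 'a) \<Rightarrow> 'a \<Rightarrow> 'a set" where
  "orbit f x = {iter f n x | n. True}"

text \<open>Subsequential limits of the sequence of iterates, which starts at index 1.\<close>

definition omega_limit_set :: "'a topology \<Rightarrow> (nat \<Rightarrow> 'a \<Rightarrow> 'a) \<Rightarrow> 'a \<Rightarrow> 'a set" where
  "omega_limit_set X f x =
     {y. \<exists>r. strict_mono r \<and> limitin X ((\<lambda>n. iter f (Suc n) x) \<circ> r) y sequentially}"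

definition TT :: "'a topology \<Rightarrow> (nat \<Rightarrow> 'a \<Rightarrow> 'a) \<Rightarrow> bool" where
  "TT X f \<longleftrightarrow> (\<forall>U V. openin X U \<and> U \<noteq> {} \<and> openin X V \<and> V \<noteq> {} \<longrightarrow>
     (\<exists>n\<ge>1. iter f n ` U \<inter> V \<noteq> {}))"

definition TT0 :: "'a topology \<Rightarrow> (nat \<Rightarrow> 'a \<Rightarrow> 'a) \<Rightarrow> bool" where
  "TT0 X f \<longleftrightarrow> (\<forall>U V. openin X U \<and> U \<noteq> {} \<and> openin X V \<and> V \<noteq> {} \<longrightarrow>
     (\<exists>n. iter f n ` U \<inter> V \<noteq> {}))"

definition OP :: "'a topology \<Rightarrow> (nat \<Rightarrow> 'a \<Rightarrow> 'a) \<Rightarrow> bool" where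
  "OP X f \<longleftrightarrow> (\<forall>U. openin X U \<and> U \<noteq> {} \<longrightarrow> dense_subset X (\<Union>n\<in>{1..}. iter f n ` U))"

definition OP0 :: "'a topology \<Rightarrow> (nat \<Rightarrow> 'a \<Rightarrow> 'a) \<Rightarrow> bool" where
  "OP0 X f \<longleftrightarrow> (\<forall>U. openin X U \<and> U \<noteq> {} \<longrightarrow> dense_subset X (\<Union>n. iter f n ` U))"

definition TT_minus :: "'a topology \<Rightarrow> (nat \<Rightarrow> 'a \<Rightarrow> 'a) \<Rightarrow> bool" where
  "TT_minus X f \<longleftrightarrow> (\<forall>U V. openin X U \<and> U \<noteq> {} \<and> openin X V \<and> V \<noteq> {} \<longrightarrow>
     (\<exists>n\<ge>1. iter_preimage X f n U \<inter> V \<noteq> {}))"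

definition TT0_minus :: "'a topology \<Rightarrow> (nat \<Rightarrow> 'a \<Rightarrow> 'a) \<Rightarrow> bool" where
  "TT0_minus X f \<longleftrightarrow> (\<forall>U V. openin X U \<and> U \<noteq> {} \<and> openin X V \<and> V \<noteq> {} \<longrightarrow>
     (\<exists>n. iter_preimage X f n U \<inter> V \<noteq> {}))"

definition OP_minus :: "'a topology \<Rightarrow> (nat \<Rightarrow> 'a \<Rightarrow> 'a) \<Rightarrow> bool" where
  "OP_minus X f \<longleftrightarrow>
     (\<forall>U. openin X U \<and> U \<noteq> {} \<longrightarrow> dense_subset X (\<Union>n\<in>{1..}. iter_preimage X f n U))"

definition OP0_minus :: "'a topology \<Rightarrow> (nat \<Rightarrow> 'a \<Rightarrow> 'a) \<Rightarrow> bool" where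
  "OP0_minus X f \<longleftrightarrow>
     (\<forall>U. openin X U \<and> U \<noteq> {} \<longrightarrow> dense_subset X (\<Union>n. iter_preimage X f n U))"

definition DDO :: "'a topology \<Rightarrow> (nat \<Rightarrow> 'a \<Rightarrow> 'a) \<Rightarrow> bool" where
  "DDO X f \<longleftrightarrow>
     (\<exists>A. gdelta_in X A \<and> dense_subset X A \<and> (\<forall>x\<in>A. dense_subset X (orbit f x)))"

definition D_omega :: "'a topology \<Rightarrow> (nat \<Rightarrow> 'a \<Rightarrow> 'a) \<Rightarrow> bool" where
  "D_omega X f \<longleftrightarrow>
     (\<exists>A. gdelta_in X A \<and> dense_subset X A \<and> (\<forall>x\<in>A. omega_limit_set X f x = topspace X))"

definition full_omega :: "'a topology \<Rightarrow> (nat \<Rightarrow> 'a \<Rightarrow> 'a) \<Rightarrow> bool" where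
  "full_omega X f \<longleftrightarrow> (\<exists>x\<in>topspace X. omega_limit_set X f x = topspace X)"

definition DO :: "'a topology \<Rightarrow> (nat \<Rightarrow> 'a \<Rightarrow> 'a) \<Rightarrow> bool" where
  "DO X f \<longleftrightarrow> (\<exists>x\<in>topspace X. dense_subset X (orbit f x))"

definition transitivity_conditions :: "('a topology \<Rightarrow> (nat \<Rightarrow> 'a \<Rightarrow> 'a) \<Rightarrow> bool) list" where
  "transitivity_conditions =
     [TT, TT0, OP, OP0, TT_minus, TT0_minus, OP_minus, OP0_minus, DDO, D_omega]"

text \<open>The hypotheses on a space with carrier M and metric d, and on a system f on it.\<close>

definition perfect_compact_metric_system ::
    "'a set \<Rightarrow> ('a \<Rightarrow> 'a \<Rightarrow> real) \<Rightarrow> (nat \<Rightarrow> 'a \<Rightarrow> 'a) \<Rightarrow> bool" where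
  "perfect_compact_metric_system M d f \<longleftrightarrow>
     Metric_space M d \<and> M \<noteq> {} \<and>
     compact_space (Metric_space.mtopology M d) \<and>
     no_isolated_points (Metric_space.mtopology M d) \<and>
     nonautonomous_system (Metric_space.mtopology M d) f"

end

theory Submission
  imports Defs
begin

text \<open>The forward and backward versions of transitivity are related by taking preimages, so the
  heart of the matter is the passage from (TT$_0$) to (D$\omega$): by the Baire category theorem
  the points with dense orbit form a dense $G_\delta$ set, and in the absence of isolated points a
  dense orbit has full omega-limit set. For the failure of the converse, collapse half of the unit
  interval to a common fixed point while the orbit of the endpoint 1 runs through all rationals of
  $(0,1]$.\<close>

section \<open>Density, countable bases and subsequences in metric spaces\<close>

lemma dense_subset_iff:
  "dense_subset X A \<longleftrightarrow>
     A \<subseteq> topspace X \<and> (\<forall>V. openin X V \<and> V \<noteq> {} \<longrightarrow> A \<inter> V \<noteq> {})"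
  by (simp add: dense_subset_def dense_intersects_open)

text \<open>Finite nets for the radii \<open>1 / real (Suc n)\<close> give countably many balls.
  They form a base: a net ball of radius below \<open>r / 2\<close> that contains \<open>x\<close>
  lies inside \<open>mball x r\<close>. This supplies the countable family to which Baire's theorem
  is applied.\<close>

lemma (in Metric_space) second_countable_mtopology:
  assumes "mtotally_bounded M"
  shows "second_countable mtopology"
proof -
  have "\<exists>K. finite K \<and> K \<subseteq> M \<and> M \<subseteq> (\<Union>x\<in>K. mball x (1 / real (Suc n)))" for n
    using assms[unfolded mtotally_bounded_def, rule_format, of "1 / real (Suc n)"] by simp
  then obtain K where K: "\<And>n. finite (K n)" "\<And>n. K n \<subseteq> M"
      "\<And>n. M \<subseteq> (\<Union>x\<in>K n. mball x (1 / real (Suc n)))"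
    by metis
  define \<B> where "\<B> = (\<Union>n. (\<lambda>x. mball x (1 / real (Suc n))) ` K n)"
  have "countable \<B>"
    unfolding \<B>_def by (simp add: K(1) countable_finite)
  moreover have "\<forall>V\<in>\<B>. openin mtopology V"
    by (auto simp: \<B>_def)
  moreover have "\<exists>V\<in>\<B>. x \<in> V \<and> V \<subseteq> U" if U: "openin mtopology U" "x \<in> U" for U x
  proof -
    obtain r where r: "r > 0" "mball x r \<subseteq> U"
      using U by (meson openin_mtopology)
    have x: "x \<in> M"
      using U openin_subset by fastforce
    obtain n where n: "1 / real (Suc n) < r / 2"
      using r(1) by (meson half_gt_zero nat_approx_posE)
    obtain k where k: "k \<in> K n" "x \<in> mball k (1 / real (Suc n))"
      using K(3)[of n] x by blast
    have "mball k (1 / real (Suc n)) \<subseteq> mball x r"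
    proof
      fix y assume y: "y \<in> mball k (1 / real (Suc n))"
      have "d x y \<le> d x k + d k y"
        using x y by (auto intro: triangle)
      then show "y \<in> mball x r"
        using x y k n by (auto simp: commute)
    qed
    with r k show ?thesis
      unfolding \<B>_def by blast
  qed
  ultimately show ?thesis
    unfolding second_countable_def by blast
qed

text \<open>Indices are chosen recursively, each beyond the previous one, so that the
  \<open>k\<close>-th chosen term is within \<open>1 / real (Suc k)\<close> of
  \<open>y\<close>.\<close>

lemma (in Metric_space) limit_point_imp_subsequence:
  fixes s :: "nat \<Rightarrow> 'a"
  assumes y: "y \<in> M" and s: "\<And>n. s n \<in> M"
    and freq: "\<And>\<epsilon> N. \<epsilon> > 0 \<Longrightarrow> \<exists>n>N. d (s n) y < \<epsilon>"
  shows "\<exists>r. strict_mono r \<and> limitin mtopology (s \<circ> r) y sequentially"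
proof -
  have "\<exists>r. \<forall>k. d (s (r k)) y < 1 / real (Suc k) \<and> r k < r (Suc k)"
  proof (rule dependent_nat_choice)
    show "\<exists>n. d (s n) y < 1 / real (Suc 0)"
      using freq[of 1 0] by auto
  next
    fix n k
    show "\<exists>m. d (s m) y < 1 / real (Suc (Suc k)) \<and> n < m"
      using freq[of "1 / real (Suc (Suc k))" n] by auto
  qed
  then obtain r where r: "\<And>k. d (s (r k)) y < 1 / real (Suc k)" "\<And>k. r k < r (Suc k)"
    by blast
  have "\<exists>N. \<forall>n\<ge>N. d (s (r n)) y < \<epsilon>" if "\<epsilon> > 0" for \<epsilon>
  proof -
    obtain N where N: "1 / real (Suc N) < \<epsilon>"
      using \<open>\<epsilon> > 0\<close> by (meson nat_approx_posE)
    have "d (s (r n)) y < \<epsilon>" if "n \<ge> N" for n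
    proof -
      have "1 / real (Suc n) \<le> 1 / real (Suc N)"
        using that by (intro divide_left_mono) auto
      then show ?thesis
        using r(1)[of n] N by linarith
    qed
    then show ?thesis by blast
  qed
  then have "limitin mtopology (s \<circ> r) y sequentially"
    using y s by (simp add: limit_metric_sequentially)
  moreover have "strict_mono r"
    using r(2) by (simp add: strict_mono_Suc_iff)
  ultimately show ?thesis by blast
qed

text \<open>Finite sets are closed in a T1 space, so removing them preserves openness. If nothing
  remained, \<open>U\<close> would be finite, and removing all its points but one would leave an
  open singleton.\<close>

lemma openin_Diff_finite_nonempty:
  assumes "t1_space X" "no_isolated_points X" "openin X U" "U \<noteq> {}" "finite F"
  shows "openin X (U - F)" "U - F \<noteq> {}"
proof -
  have *: "openin X (U - G)" if "finite G" for G
  proof -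
    have "closedin X (topspace X \<inter> G)"
      using assms(1) that by (simp add: t1_space_closedin_finite)
    then have "openin X (U - topspace X \<inter> G)"
      using assms(3) by blast
    moreover have "U - topspace X \<inter> G = U - G"
      using openin_subset[OF assms(3)] by blast
    ultimately show ?thesis by simp
  qed
  show "openin X (U - F)"
    using * assms(5) by blast
  show "U - F \<noteq> {}"
  proof
    assume "U - F = {}"
    then have "finite U"
      using assms(5) by (simp add: finite_subset)
    obtain y where "y \<in> U"
      using assms(4) by blast
    then have "U - (U - {y}) = {y}" by blast
    then have "openin X {y}"
      using *[of "U - {y}"] \<open>finite U\<close> by simp
    then show False
      using assms(2) openin_subset unfolding no_isolated_points_def by fastforce
  qed
qed

section \<open>Iterates, dense orbits and omega-limit sets\<close>

lemma continuous_map_iter: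
  assumes "nonautonomous_system X f"
  shows "continuous_map X X (iter f n)"
proof (induction n)
  case 0
  show ?case by (simp add: continuous_map_id)
next
  case (Suc n)
  then show ?case
    using assms unfolding nonautonomous_system_def iter.simps
    by (intro continuous_map_compose) auto
qed

lemma iter_in_topspace:
  "\<lbrakk>nonautonomous_system X f; x \<in> topspace X\<rbrakk> \<Longrightarrow> iter f n x \<in> topspace X"
  using continuous_map_iter continuous_map_funspace by fastforce

lemma openin_iter_preimage:
  "\<lbrakk>nonautonomous_system X f; openin X U\<rbrakk> \<Longrightarrow> openin X (iter_preimage X f n U)"
  unfolding iter_preimage_def by (rule openin_continuous_map_preimage[OF continuous_map_iter])

lemma dense_orbit_iff:
  assumes "nonautonomous_system X f" "x \<in> topspace X"
  shows "dense_subset X (orbit f x) \<longleftrightarrow>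
    (\<forall>V. openin X V \<and> V \<noteq> {} \<longrightarrow> (\<exists>n. iter f n x \<in> V))"
  using iter_in_topspace[OF assms] by (fastforce simp: dense_subset_iff orbit_def)

text \<open>The sequence defining the omega-limit set starts at index 1, so the visit happens at a
  positive time. This is what yields \<open>TT\<close> and not merely \<open>TT0\<close> from
  \<open>D_omega\<close>.\<close>

lemma omega_limit_set_full_imp_visit:
  assumes "omega_limit_set X f x = topspace X" "openin X V" "V \<noteq> {}"
  shows "\<exists>n\<ge>1. iter f n x \<in> V"
proof -
  obtain y where y: "y \<in> V"
    using assms by blast
  then have "y \<in> omega_limit_set X f x"
    using assms openin_subset by blast
  then obtain r where "limitin X ((\<lambda>n. iter f (Suc n) x) \<circ> r) y sequentially"
    by (auto simp: omega_limit_set_def)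
  then obtain N where "\<forall>n\<ge>N. iter f (Suc (r n)) x \<in> V"
    using assms(2) y unfolding limitin_sequentially o_def by meson
  then show ?thesis
    by (intro exI[of _ "Suc (r N)"]) auto
qed

text \<open>Without isolated points, deleting the first finitely many points of a dense orbit from an
  open set leaves a nonempty open set, so the orbit returns at arbitrarily late times.\<close>

lemma (in Metric_space) omega_limit_set_full_iff_dense_orbit:
  assumes sys: "nonautonomous_system mtopology f" and perfect: "no_isolated_points mtopology"
    and x: "x \<in> M"
  shows "omega_limit_set mtopology f x = topspace mtopology \<longleftrightarrow> dense_subset mtopology (orbit f x)"
proof
  assume "omega_limit_set mtopology f x = topspace mtopology"
  then show "dense_subset mtopology (orbit f x)"
    using omega_limit_set_full_imp_visit[of mtopology f x] x
    by (subst dense_orbit_iff[OF sys]) auto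
next
  assume dense: "dense_subset mtopology (orbit f x)"
  have "t1_space mtopology"
    by (simp add: Hausdorff_imp_t1_space Hausdorff_space_mtopology)
  note nonempty = openin_Diff_finite_nonempty[OF this perfect]
  have "y \<in> omega_limit_set mtopology f x" if y: "y \<in> M" for y
  proof -
    have "\<exists>n>N. d (iter f (Suc n) x) y < \<epsilon>" if "\<epsilon> > 0" for \<epsilon> N
    proof -
      \<comment> \<open>The points visited up to time \<open>Suc N\<close> are removed from the
        ball, so the next visit must come later. The bound is \<open>Suc N\<close> because the
        sequence is shifted: its index \<open>m\<close> is time \<open>Suc m\<close>.\<close>
      let ?F = "(\<lambda>n. iter f n x) ` {..Suc N}"
      have "mball y \<epsilon> \<noteq> {}"
        using y that by (metis centre_in_mball_iff empty_iff)
      then have "openin mtopology (mball y \<epsilon> - ?F)" "mball y \<epsilon> - ?F \<noteq> {}"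
        using nonempty by auto
      then obtain n where n: "iter f n x \<in> mball y \<epsilon> - ?F"
        using dense x dense_orbit_iff[OF sys] by (metis topspace_mtopology)
      then have "n > Suc N"
        by (metis DiffD2 atMost_iff image_eqI not_le)
      then obtain m where "n = Suc m" "m > N"
        by (cases n) auto
      then show ?thesis
        using n by (auto simp: commute)
    qed
    then show ?thesis
      unfolding omega_limit_set_def
      using limit_point_imp_subsequence[of y "\<lambda>n. iter f (Suc n) x"] y x
        iter_in_topspace[OF sys] by (simp del: iter.simps)
  qed
  moreover have "omega_limit_set mtopology f x \<subseteq> M"
    using limitin_mspace by (auto simp: omega_limit_set_def)
  ultimately show "omega_limit_set mtopology f x = topspace mtopology"
    by auto
qed

section \<open>Elementary implications between the transitivity conditions\<close>

lemma TT_iff_OP: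
  assumes "nonautonomous_system X f"
  shows "TT X f \<longleftrightarrow> OP X f"
proof -
  have "(\<Union>n\<in>{1..}. iter f n ` U) \<subseteq> topspace X" if "openin X U" for U
    using that openin_subset iter_in_topspace[OF assms] by fastforce
  moreover have "(\<Union>n\<in>{1..}. iter f n ` U) \<inter> V \<noteq> {} \<longleftrightarrow> (\<exists>n\<ge>1. iter f n ` U \<inter> V \<noteq> {})" for U V
    by blast
  ultimately show ?thesis
    unfolding TT_def OP_def dense_subset_iff by meson
qed

lemma TT0_iff_OP0:
  assumes "nonautonomous_system X f"
  shows "TT0 X f \<longleftrightarrow> OP0 X f"
proof -
  have "(\<Union>n. iter f n ` U) \<subseteq> topspace X" if "openin X U" for U
    using that openin_subset iter_in_topspace[OF assms] by fastforce
  moreover have "(\<Union>n. iter f n ` U) \<inter> V \<noteq> {} \<longleftrightarrow> (\<exists>n. iter f n ` U \<inter> V \<noteq> {})" for U V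
    by blast
  ultimately show ?thesis
    unfolding TT0_def OP0_def dense_subset_iff by meson
qed

lemma TT_minus_iff_OP_minus: "TT_minus X f \<longleftrightarrow> OP_minus X f"
proof -
  have "(\<Union>n\<in>{1..}. iter_preimage X f n U) \<subseteq> topspace X" for U
    by (auto simp: iter_preimage_def)
  moreover have "(\<Union>n\<in>{1..}. iter_preimage X f n U) \<inter> V \<noteq> {} \<longleftrightarrow>
      (\<exists>n\<ge>1. iter_preimage X f n U \<inter> V \<noteq> {})" for U V
    by blast
  ultimately show ?thesis
    unfolding TT_minus_def OP_minus_def dense_subset_iff by meson
qed

lemma TT0_minus_iff_OP0_minus: "TT0_minus X f \<longleftrightarrow> OP0_minus X f"
proof -
  have "(\<Union>n. iter_preimage X f n U) \<subseteq> topspace X" for U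
    by (auto simp: iter_preimage_def)
  moreover have "(\<Union>n. iter_preimage X f n U) \<inter> V \<noteq> {} \<longleftrightarrow>
      (\<exists>n. iter_preimage X f n U \<inter> V \<noteq> {})" for U V
    by blast
  ultimately show ?thesis
    unfolding TT0_minus_def OP0_minus_def dense_subset_iff by meson
qed

text \<open>Either side asserts a point of \<open>V\<close> that reaches \<open>U\<close> after
  \<open>n\<close> steps. Passing to preimages thus only swaps the roles of the two open
  sets.\<close>

lemma iter_preimage_meets_iff:
  assumes "V \<subseteq> topspace X"
  shows "iter_preimage X f n U \<inter> V \<noteq> {} \<longleftrightarrow> iter f n ` V \<inter> U \<noteq> {}"
  using assms by (auto simp: iter_preimage_def)

lemma TT_iff_TT_minus: "TT X f \<longleftrightarrow> TT_minus X f"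
  unfolding TT_def TT_minus_def by (metis iter_preimage_meets_iff openin_subset)

lemma TT0_iff_TT0_minus: "TT0 X f \<longleftrightarrow> TT0_minus X f"
  unfolding TT0_def TT0_minus_def by (metis iter_preimage_meets_iff openin_subset)

lemma TT_imp_TT0: "TT X f \<Longrightarrow> TT0 X f"
  unfolding TT_def TT0_def by blast

text \<open>Density puts a point of \<open>A\<close> into \<open>U\<close>, and its full omega-limit
  set forces a visit to \<open>V\<close>. This closes the cycle from \<open>TT\<close> through
  \<open>TT0\<close>, \<open>DDO\<close> and \<open>D_omega\<close>.\<close>

lemma D_omega_imp_TT: "D_omega X f \<Longrightarrow> TT X f"
  unfolding TT_def
proof (intro allI impI, elim conjE)
  fix U V
  assume "D_omega X f" and U: "openin X U" "U \<noteq> {}" and V: "openin X V" "V \<noteq> {}"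
  then obtain A where A: "dense_subset X A" "\<forall>x\<in>A. omega_limit_set X f x = topspace X"
    by (auto simp: D_omega_def)
  then obtain x where "x \<in> A" "x \<in> U"
    using U unfolding dense_subset_iff by blast
  then show "\<exists>n\<ge>1. iter f n ` U \<inter> V \<noteq> {}"
    using omega_limit_set_full_imp_visit[OF _ V] A by blast
qed

lemma DDO_imp_TT0:
  assumes "DDO X f"
  shows "TT0 X f"
  unfolding TT0_def
proof (intro allI impI, elim conjE)
  fix U V
  assume U: "openin X U" "U \<noteq> {}" and V: "openin X V" "V \<noteq> {}"
  obtain A where A: "dense_subset X A" "\<forall>x\<in>A. dense_subset X (orbit f x)"
    using assms by (auto simp: DDO_def)
  then obtain x where x: "x \<in> A" "x \<in> U"
    using U unfolding dense_subset_iff by blast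
  then have "orbit f x \<inter> V \<noteq> {}"
    using A V unfolding dense_subset_iff by blast
  then show "\<exists>n. iter f n ` U \<inter> V \<noteq> {}"
    using x by (auto simp: orbit_def)
qed

section \<open>The Baire category argument\<close>

text \<open>The points with dense orbit are those visiting every set of a countable base. This is a
  countable intersection of open sets, which are dense by topological transitivity.\<close>

lemma (in Metric_space) TT0_imp_DDO:
  assumes compact: "compact_space mtopology" and sys: "nonautonomous_system mtopology f"
    and TT0: "TT0 mtopology f"
  shows "DDO mtopology f"
proof -
  have complete: "mcomplete" and "mtotally_bounded M"
    using compact by (auto simp: compact_space_eq_mcomplete_mtotally_bounded)
  then obtain \<B> where \<B>: "countable \<B>" "\<And>V. V \<in> \<B> \<Longrightarrow> openin mtopology V"
      "\<And>U x. \<lbrakk>openin mtopology U; x \<in> U\<rbrakk> \<Longrightarrow> \<exists>V\<in>\<B>. x \<in> V \<and> V \<subseteq> U"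
    using second_countable_mtopology unfolding second_countable_def by metis
  let ?G = "\<lambda>V. \<Union>n. iter_preimage mtopology f n V"
  \<comment> \<open>Inserting \<open>M\<close> keeps the intersection inside the space. The empty
    set is left out of the base because its preimages are empty, hence in general not dense.\<close>
  define \<G> where "\<G> = insert M (?G ` (\<B> - {{}}))"
  have "countable \<G>"
    using \<B>(1) by (simp add: \<G>_def)
  have G: "openin mtopology T \<and> mtopology closure_of T = M" if "T \<in> \<G>" for T
  proof (cases "T = M")
    case True
    then show ?thesis
      by (metis closure_of_topspace openin_topspace topspace_mtopology)
  next
    case False
    then obtain V where V: "V \<in> \<B>" "V \<noteq> {}" "T = ?G V"
      using \<open>T \<in> \<G>\<close> False unfolding \<G>_def by blast
    \<comment> \<open>Transitivity enters in the form \<open>OP0_minus\<close>, which is exactly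
      density of these unions of preimages.\<close>
    have "dense_subset mtopology T"
      using TT0 V \<B>(2) unfolding TT0_iff_TT0_minus TT0_minus_iff_OP0_minus OP0_minus_def by blast
    then show ?thesis
      using V \<B>(2) openin_iter_preimage[OF sys] by (auto simp: dense_subset_def)
  qed
  have dense: "mtopology closure_of \<Inter>\<G> = M"
    using metric_Baire_category[OF complete \<open>countable \<G>\<close> G] .
  have "gdelta_in mtopology (\<Inter>\<G>)"
    using \<open>countable \<G>\<close> G by (intro gdelta_in_Inter) (auto simp: \<G>_def intro: open_imp_gdelta_in)
  moreover have "\<Inter>\<G> \<subseteq> M"
    by (auto simp: \<G>_def)
  moreover have "dense_subset mtopology (orbit f x)" if x: "x \<in> \<Inter>\<G>" for x
  proof -
    have "\<exists>n. iter f n x \<in> V" if V: "openin mtopology V" "V \<noteq> {}" for V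
    proof -
      obtain W where W: "W \<in> \<B>" "W \<noteq> {}" "W \<subseteq> V"
        using \<B>(3) V by blast
      then have "x \<in> ?G W"
        using x by (auto simp: \<G>_def)
      then show ?thesis
        using W by (auto simp: iter_preimage_def)
    qed
    then show ?thesis
      using x by (subst dense_orbit_iff[OF sys]) (auto simp: \<G>_def)
  qed
  ultimately show ?thesis
    using dense unfolding DDO_def
    by (intro exI[of _ "\<Inter>\<G>"]) (simp add: dense_subset_def)
qed

section \<open>Equivalence of the ten conditions and their consequences\<close>

context Metric_space
begin

context
  fixes f
  assumes compact: "compact_space mtopology"
    and perfect: "no_isolated_points mtopology"
    and sys: "nonautonomous_system mtopology f"
begin

text \<open>The same set \<open>A\<close> serves both conditions, since a dense orbit and a full
  omega-limit set are equivalent point by point.\<close>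

lemma DDO_iff_D_omega: "DDO mtopology f \<longleftrightarrow> D_omega mtopology f"
proof -
  have "(\<forall>x\<in>A. dense_subset mtopology (orbit f x)) \<longleftrightarrow>
      (\<forall>x\<in>A. omega_limit_set mtopology f x = topspace mtopology)" if "dense_subset mtopology A" for A
    using that omega_limit_set_full_iff_dense_orbit[OF sys perfect]
    by (metis dense_subset_def subsetD topspace_mtopology)
  then show ?thesis
    unfolding DDO_def D_omega_def by blast
qed

text \<open>\<open>DDO\<close> serves as the hub: comparing each condition with it gives all
  pairwise equivalences at once.\<close>

lemma transitivity_condition_iff_DDO:
  assumes "P \<in> set transitivity_conditions"
  shows "P mtopology f \<longleftrightarrow> DDO mtopology f"
proof -
  have "TT mtopology f \<longleftrightarrow> DDO mtopology f" "TT0 mtopology f \<longleftrightarrow> DDO mtopology f"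
    using TT0_imp_DDO[OF compact sys] DDO_imp_TT0 DDO_iff_D_omega D_omega_imp_TT TT_imp_TT0
    by blast+
  then show ?thesis
    using assms DDO_iff_D_omega TT_iff_OP[OF sys] TT0_iff_OP0[OF sys]
    unfolding transitivity_conditions_def
    by (auto simp flip: TT_iff_TT_minus TT0_iff_TT0_minus TT_minus_iff_OP_minus
        TT0_minus_iff_OP0_minus)
qed

lemma full_omega_iff_DO: "full_omega mtopology f \<longleftrightarrow> DO mtopology f"
  unfolding full_omega_def DO_def
  using omega_limit_set_full_iff_dense_orbit[OF sys perfect] by auto

lemma DDO_imp_DO:
  assumes "DDO mtopology f" "M \<noteq> {}"
  shows "DO mtopology f"
proof -
  obtain A where A: "dense_subset mtopology A" "\<forall>x\<in>A. dense_subset mtopology (orbit f x)"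
    using assms by (auto simp: DDO_def)
  then have "A \<noteq> {}" "A \<subseteq> topspace mtopology"
    using assms(2) by (auto simp: dense_subset_def)
  then show ?thesis
    using A unfolding DO_def by blast
qed

end

end

section \<open>The counterexample on the unit interval\<close>

text \<open>The maps after the first are truncated dilations chosen such that the iterate with index n
  sends 1 to \<open>e (n - 1)\<close>. Both subtractions truncate only for the map with index 0, which is
  never applied.\<close>

definition collapse_system :: "(nat \<Rightarrow> real) \<Rightarrow> nat \<Rightarrow> real \<Rightarrow> real" where
  "collapse_system e n =
     (if n = 1 then (\<lambda>x. e 0 * max 0 (2 * x - 1)) else (\<lambda>x. min 1 (e (n - 1) / e (n - 2) * x)))"

context
  fixes e :: "nat \<Rightarrow> real"
  assumes e: "range e = {0<..1} \<inter> \<rat>"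
begin

lemma e_bounds: "0 < e n" "e n \<le> 1"
  using e by (metis IntD1 greaterThanAtMost_iff rangeI)+

lemma nonautonomous_collapse_system:
  "nonautonomous_system (top_of_set {0..1}) (collapse_system e)"
proof -
  have "collapse_system e n \<in> {0..1} \<rightarrow> {0..1}" for n
  proof
    fix x :: real
    assume x: "x \<in> {0..1}"
    have "0 \<le> e (n - 1) / e (n - 2)"
      using e_bounds(1) by (intro divide_nonneg_pos less_imp_le)
    then have "0 \<le> e (n - 1) / e (n - 2) * x"
      using x by (intro mult_nonneg_nonneg) auto
    moreover have "e 0 * max 0 (2 * x - 1) \<le> 1" "0 \<le> e 0 * max 0 (2 * x - 1)"
      using x e_bounds[of 0] by (auto intro!: mult_le_one)
    ultimately show "collapse_system e n x \<in> {0..1}"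
      unfolding collapse_system_def by simp
  qed
  moreover have "continuous_on {0..1} (collapse_system e n)" for n
    using less_imp_neq[OF e_bounds(1)[of "n - 2"]]
    by (auto simp: collapse_system_def intro!: continuous_intros)
  ultimately show ?thesis
    by (auto simp: nonautonomous_system_def)
qed

text \<open>The first map sends 1 to \<open>e 0\<close>, and each later dilation factor
  \<open>e (Suc n) / e n\<close> carries \<open>e n\<close> to \<open>e (Suc n)\<close>. The
  truncation at 1 has no effect on this orbit because \<open>e\<close> is bounded by 1.\<close>

lemma iter_collapse_system_1: "iter (collapse_system e) (Suc n) 1 = e n"
proof (induction n)
  case 0
  show ?case by (simp add: collapse_system_def)
next
  case (Suc n)
  have "iter (collapse_system e) (Suc (Suc n)) 1 = collapse_system e (Suc (Suc n)) (e n)"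
    using Suc by simp
  also have "\<dots> = e (Suc n)"
    using e_bounds[of n] e_bounds[of "Suc n"] by (simp add: collapse_system_def)
  finally show ?case .
qed

text \<open>The first map sends everything up to 1/2 to 0, which all later maps fix.\<close>

lemma iter_collapse_system_lower_half:
  "x \<le> 1 / 2 \<Longrightarrow> iter (collapse_system e) (Suc n) x = 0"
proof (induction n)
  case 0
  then show ?case by (simp add: collapse_system_def)
next
  case (Suc n)
  then have "iter (collapse_system e) (Suc (Suc n)) x = collapse_system e (Suc (Suc n)) 0"
    by simp
  also have "\<dots> = 0"
    by (simp add: collapse_system_def)
  finally show ?case .
qed

lemma DO_collapse_system: "DO (top_of_set {0..1}) (collapse_system e)"
proof -
  have "\<exists>n. iter (collapse_system e) n 1 \<in> V"
    if V: "openin (top_of_set {0..1}) V" "V \<noteq> {}" for V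
  proof -
    obtain T where T: "open T" "V = {0..1} \<inter> T"
      using V by (auto simp: openin_open)
    \<comment> \<open>A relatively open set may contain an endpoint, so \<open>T\<close> is first
      cut down to the open interval. There it is open in the real line and contains a
      rational.\<close>
    have "T \<inter> closure {0<..<1} \<noteq> {}"
      using T V by (auto simp: closure_greaterThanLessThan)
    then have "T \<inter> {0<..<1} \<noteq> {}"
      using T open_Int_closure_eq_empty by blast
    moreover have "open (T \<inter> {0<..<1})"
      using T(1) by (intro open_Int) auto
    ultimately have "T \<inter> {0<..<1} \<inter> \<rat> \<noteq> {}"
      using open_Int_closure_eq_empty[of "T \<inter> {0<..<1}" \<rat>] Rats_closure_real by auto
    then obtain y where y: "y \<in> T" "y \<in> {0<..<1}" "y \<in> \<rat>"
      by blast
    then have "y \<in> range e" "y \<in> {0..1}"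
      unfolding e by simp_all
    then show ?thesis
      using y T iter_collapse_system_1 by (metis IntI rangeE)
  qed
  then have "dense_subset (top_of_set {0..1}) (orbit (collapse_system e) 1)"
    using dense_orbit_iff[OF nonautonomous_collapse_system] by simp
  then show ?thesis
    by (auto simp: DO_def)
qed

text \<open>The two open halves of the interval are disjoint at time 0, and from time 1 on the lower
  half sits at the point 0, outside the upper half.\<close>

lemma not_TT0_collapse_system: "\<not> TT0 (top_of_set {0..1}) (collapse_system e)"
proof
  assume TT0: "TT0 (top_of_set {0..1}) (collapse_system e)"
  let ?U = "{0..1} \<inter> {..<1/2::real}" and ?V = "{0..1} \<inter> {1/2::real<..}"
  have "openin (top_of_set {0..1}) ?U" "openin (top_of_set {0..1}) ?V"
    by (auto intro: openin_open_Int)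
  moreover have "0 \<in> ?U" "1 \<in> ?V"
    by auto
  ultimately obtain n where "iter (collapse_system e) n ` ?U \<inter> ?V \<noteq> {}"
    using TT0 unfolding TT0_def by blast
  then obtain x where "x \<in> ?U" "iter (collapse_system e) n x \<in> ?V"
    by blast
  then show False
    using iter_collapse_system_lower_half[of x] by (cases n) auto
qed

end

text \<open>An isolated point would form a nonempty clopen set, hence by connectedness the whole
  interval.\<close>

lemma no_isolated_points_unit_interval: "no_isolated_points (top_of_set {0..1::real})"
  unfolding no_isolated_points_def
proof (intro ballI notI)
  fix x :: real
  assume "openin (top_of_set {0..1}) {x}" and x: "x \<in> topspace (top_of_set {0..1})"
  moreover have "closedin (top_of_set {0..1}) {x}"
    using x by (auto intro: closed_subset)
  ultimately have "{x} = {0..1}"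
    using connected_clopen[of "{0..1::real}"] by auto
  then have "0 \<in> {x}" "1 \<in> {x}"
    by auto
  then show False by simp
qed

text \<open>Translates between the carrier-and-metric form used in the theorem and the subspace
  topology in which the counterexample is computed.\<close>

lemma mtopology_unit_interval:
  "Metric_space {0..1::real} dist" "Metric_space.mtopology {0..1::real} dist = top_of_set {0..1}"
proof -
  interpret Submetric UNIV dist "{0..1::real}"
    by unfold_locales auto
  show "Metric_space {0..1::real} dist"
    by (rule sub.Metric_space_axioms)
  show "Metric_space.mtopology {0..1::real} dist = top_of_set {0..1}"
    using mtopology_submetric by simp
qed

theorem theorem8:
  shows "(\<forall>(M :: 'a set) d f. perfect_compact_metric_system M d f \<longrightarrow>
            (let X = Metric_space.mtopology M d in
              (\<forall>P\<in>set transitivity_conditions. \<forall>Q\<in>set transitivity_conditions. P X f \<longleftrightarrow> Q X f) \<and>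
              (\<forall>P\<in>set transitivity_conditions. P X f \<longrightarrow> full_omega X f \<and> DO X f) \<and>
              (full_omega X f \<longleftrightarrow> DO X f)))
       \<and> (\<exists>(M :: real set) d f. perfect_compact_metric_system M d f \<and>
            (let X = Metric_space.mtopology M d in
              full_omega X f \<and> DO X f \<and> (\<forall>P\<in>set transitivity_conditions. \<not> P X f)))"
proof (rule conjI)
  show "\<forall>(M :: 'a set) d f. perfect_compact_metric_system M d f \<longrightarrow>
            (let X = Metric_space.mtopology M d in
              (\<forall>P\<in>set transitivity_conditions. \<forall>Q\<in>set transitivity_conditions. P X f \<longleftrightarrow> Q X f) \<and>
              (\<forall>P\<in>set transitivity_conditions. P X f \<longrightarrow> full_omega X f \<and> DO X f) \<and>
              (full_omega X f \<longleftrightarrow> DO X f))"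
  proof (intro allI impI)
    fix M :: "'a set" and d f
    assume sys: "perfect_compact_metric_system M d f"
    interpret Metric_space M d
      using sys by (simp add: perfect_compact_metric_system_def)
    have "M \<noteq> {}" and *: "compact_space mtopology" "no_isolated_points mtopology"
        "nonautonomous_system mtopology f"
      using sys by (auto simp: perfect_compact_metric_system_def)
    then show "let X = mtopology in
          (\<forall>P\<in>set transitivity_conditions. \<forall>Q\<in>set transitivity_conditions. P X f \<longleftrightarrow> Q X f) \<and>
          (\<forall>P\<in>set transitivity_conditions. P X f \<longrightarrow> full_omega X f \<and> DO X f) \<and>
          (full_omega X f \<longleftrightarrow> DO X f)"
      using transitivity_condition_iff_DDO[OF *] full_omega_iff_DO[OF *] DDO_imp_DO[OF *]
      unfolding Let_def by blast
  qed
next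
  let ?X = "top_of_set {0..1::real}"
  \<comment> \<open>Nonemptiness and countability provide an enumeration \<open>e\<close> of the
    rationals in (0,1]; it may repeat values.\<close>
  have "1 \<in> {0<..1::real} \<inter> \<rat>"
    by simp
  moreover have "countable ({0<..1::real} \<inter> \<rat>)"
    by (simp add: countable_rat)
  ultimately obtain e :: "nat \<Rightarrow> real" where e: "range e = {0<..1} \<inter> \<rat>"
    by (metis empty_iff range_from_nat_into)
  interpret Metric_space "{0..1::real}" dist
    by (rule mtopology_unit_interval)
  have *: "compact_space mtopology" "no_isolated_points mtopology"
      "nonautonomous_system mtopology (collapse_system e)"
    using no_isolated_points_unit_interval nonautonomous_collapse_system[OF e]
    by (auto simp: mtopology_unit_interval compact_space_subtopology)
  have "DO mtopology (collapse_system e)"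
    using DO_collapse_system[OF e] by (simp add: mtopology_unit_interval)
  moreover have "\<not> TT0 mtopology (collapse_system e)"
    using not_TT0_collapse_system[OF e] by (simp add: mtopology_unit_interval)
  \<comment> \<open>Refuting one condition refutes all ten, since each is equivalent to
    \<open>DDO\<close> for this system.\<close>
  moreover have "TT0 \<in> set transitivity_conditions"
    by (simp add: transitivity_conditions_def)
  moreover have "perfect_compact_metric_system {0..1::real} dist (collapse_system e)"
    using * Metric_space_axioms by (simp add: perfect_compact_metric_system_def)
  ultimately show "\<exists>(M :: real set) d f. perfect_compact_metric_system M d f \<and>
            (let X = Metric_space.mtopology M d in
              full_omega X f \<and> DO X f \<and> (\<forall>P\<in>set transitivity_conditions. \<not> P X f))"
    using transitivity_condition_iff_DDO[OF *] full_omega_iff_DO[OF *]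
    unfolding Let_def by blast
qed

end
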